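(* Let $n\ge 2$ and let $\alpha,\beta\in\mathcal{SS}'_n$. Then, for the starred Green's relations on the semigroup $\mathcal{SS}'_n$: (i) $\alpha\,\mathcal{L}^*\,\beta$ if and only if $\mathrm{Im}\,\alpha=\mathrm{Im}\,\beta$; (ii) $\alpha\,\mathcal{R}^*\,\beta$ if and only if $\ker\alpha=\ker\beta$; (iii) $\alpha\,\mathcal{H}^*\,\beta$ if and only if $\alpha=\beta$; (iv) $\alpha\,\mathcal{D}^*\,\beta$ if and only if $|\mathrm{Im}\,\alpha|=|\mathrm{Im}\,\beta|$.
   Context: Let $[n]=\{1,2,\dots,n\}$ with its usual order. $\mathcal{P}_n$ is the semigroup of all partial transformations of $[n]$ (maps whose domain and image are subsets of $[n]$, including the empty map), composed from left to right: $x(\alpha\beta)=(x\alpha)\beta$. A partial map $\alpha$ is isotone if $x\le y$ implies $x\alpha\le y\alpha$ for all $x,y\in\mathrm{Dom}\,\alpha$, and order-decreasing if $x\alpha\le x$ for all $x\in\mathrm{Dom}\,\alpha$. $\mathcal{LS}_n$ is the monoid of all isotone order-decreasing $\alpha\in\mathcal{P}_n$, and $\mathcal{SS}'_n=\{\alpha\in\mathcal{LS}_n: 1\notin \mathrm{Dom}\,\alpha\}$, a subsemigroup of $\mathcal{LS}_n$. The kernel of $\alpha$ is $\ker\alpha=\{(x,y)\in\mathrm{Dom}\,\alpha\times\mathrm{Dom}\,\alpha: x\alpha=y\alpha\}$ (so $\ker\alpha=\ker\beta$ forces $\mathrm{Dom}\,\alpha=\mathrm{Dom}\,\beta$). For a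 semigroup $S$, $S^1$ is $S$ with an identity adjoined if necessary. $(a,b)\in\mathcal{L}^*$ iff for all $x,y\in S^1$: $ax=ay\iff bx=by$. $(a,b)\in\mathcal{R}^*$ iff for all $x,y\in S^1$: $xa=ya\iff xb=yb$. $\mathcal{H}^*=\mathcal{L}^*\cap\mathcal{R}^*$, and $\mathcal{D}^*$ is the join of $\mathcal{L}^*$ and $\mathcal{R}^*$ (the smallest equivalence relation containing both). *)

theory Defs
  imports Main
begin

datatype 'a with_one = One | Elt 'a

fun mult_one :: "('a \<Rightarrow> 'a \<Rightarrow> 'a) \<Rightarrow> 'a with_one \<Rightarrow> 'a with_one \<Rightarrow> 'a with_one" where
  "mult_one m One y = y"
| "mult_one m x One = x"
| "mult_one m (Elt a) (Elt b) = Elt (m a b)"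

definition has_identity :: "'a set \<Rightarrow> ('a \<Rightarrow> 'a \<Rightarrow> 'a) \<Rightarrow> bool" where
  "has_identity S m \<longleftrightarrow> (\<exists>e\<in>S. \<forall>a\<in>S. m e a = a \<and> m a e = a)"

text \<open>For a semigroup with carrier \<open>S\<close> and multiplication \<open>m\<close>, this is \<open>S\<^sup>1\<close>:
  the new identity \<^const>\<open>One\<close> is adjoined only if \<open>S\<close> has no identity.\<close>

definition adjoin_one :: "'a set \<Rightarrow> ('a \<Rightarrow> 'a \<Rightarrow> 'a) \<Rightarrow> 'a with_one set" where
  "adjoin_one S m = (if has_identity S m then Elt ` S else insert One (Elt ` S))"

definition L_star :: "'a set \<Rightarrow> ('a \<Rightarrow> 'a \<Rightarrow> 'a) \<Rightarrow> 'a rel" where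
  "L_star S m = {(a, b). a \<in> S \<and> b \<in> S \<and>
     (\<forall>x\<in>adjoin_one S m. \<forall>y\<in>adjoin_one S m.
        mult_one m (Elt a) x = mult_one m (Elt a) y \<longleftrightarrow>
        mult_one m (Elt b) x = mult_one m (Elt b) y)}"

definition R_star :: "'a set \<Rightarrow> ('a \<Rightarrow> 'a \<Rightarrow> 'a) \<Rightarrow> 'a rel" where
  "R_star S m = {(a, b). a \<in> S \<and> b \<in> S \<and>
     (\<forall>x\<in>adjoin_one S m. \<forall>y\<in>adjoin_one S m.
        mult_one m x (Elt a) = mult_one m y (Elt a) \<longleftrightarrow>
        mult_one m x (Elt b) = mult_one m y (Elt b))}"

definition H_star :: "'a set \<Rightarrow> ('a \<Rightarrow> 'a \<Rightarrow> 'a) \<Rightarrow> 'a rel" where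
  "H_star S m = L_star S m \<inter> R_star S m"

definition D_star :: "'a set \<Rightarrow> ('a \<Rightarrow> 'a \<Rightarrow> 'a) \<Rightarrow> 'a rel" where
  "D_star S m = \<Inter> {E. equiv S E \<and> L_star S m \<subseteq> E \<and> R_star S m \<subseteq> E}"

definition partial_transformations :: "nat \<Rightarrow> (nat \<rightharpoonup> nat) set" where
  "partial_transformations n = {\<alpha>. dom \<alpha> \<subseteq> {1..n} \<and> ran \<alpha> \<subseteq> {1..n}}"

text \<open>Maps act on the right, \<open>x(\<alpha>\<beta>) = (x\<alpha>)\<beta>\<close>, whereas \<^const>\<open>map_comp\<close> applies its second argument first.\<close>

definition pcomp :: "(nat \<rightharpoonup> nat) \<Rightarrow> (nat \<rightharpoonup> nat) \<Rightarrow> (nat \<rightharpoonup> nat)" where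
  "pcomp \<alpha> \<beta> = \<beta> \<circ>\<^sub>m \<alpha>"

definition isotone :: "(nat \<rightharpoonup> nat) \<Rightarrow> bool" where
  "isotone \<alpha> \<longleftrightarrow> (\<forall>x\<in>dom \<alpha>. \<forall>y\<in>dom \<alpha>. x \<le> y \<longrightarrow> the (\<alpha> x) \<le> the (\<alpha> y))"

definition order_decreasing :: "(nat \<rightharpoonup> nat) \<Rightarrow> bool" where
  "order_decreasing \<alpha> \<longleftrightarrow> (\<forall>x\<in>dom \<alpha>. the (\<alpha> x) \<le> x)"

definition LS :: "nat \<Rightarrow> (nat \<rightharpoonup> nat) set" where
  "LS n = {\<alpha> \<in> partial_transformations n. isotone \<alpha> \<and> order_decreasing \<alpha>}"

definition SS' :: "nat \<Rightarrow> (nat \<rightharpoonup> nat) set" where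
  "SS' n = {\<alpha> \<in> LS n. 1 \<notin> dom \<alpha>}"

definition pker :: "(nat \<rightharpoonup> nat) \<Rightarrow> nat rel" where
  "pker \<alpha> = {(x, y). x \<in> dom \<alpha> \<and> y \<in> dom \<alpha> \<and> the (\<alpha> x) = the (\<alpha> y)}"

lemma pcomp_assoc: "pcomp (pcomp \<alpha> \<beta>) \<gamma> = pcomp \<alpha> (pcomp \<beta> \<gamma>)"
  by (auto simp: pcomp_def map_comp_def fun_eq_iff split: option.splits)

lemma pcomp_closed_SS':
  assumes "\<alpha> \<in> SS' n" "\<beta> \<in> SS' n"
  shows "pcomp \<alpha> \<beta> \<in> SS' n"
proof -
  have ran: "ran (pcomp \<alpha> \<beta>) \<subseteq> ran \<beta>"
    unfolding pcomp_def by (auto simp: ran_def map_comp_Some_iff)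
  have dom: "dom (pcomp \<alpha> \<beta>) \<subseteq> dom \<alpha>"
    unfolding pcomp_def by (auto simp: map_comp_Some_iff)
  have "isotone (pcomp \<alpha> \<beta>)"
    unfolding isotone_def
  proof (intro ballI impI)
    fix x y assume "x \<in> dom (pcomp \<alpha> \<beta>)" "y \<in> dom (pcomp \<alpha> \<beta>)" and le: "x \<le> y"
    then obtain x' x'' y' y'' where *: "\<alpha> x = Some x'" "\<beta> x' = Some x''"
        "\<alpha> y = Some y'" "\<beta> y' = Some y''"
      by (auto simp: pcomp_def map_comp_Some_iff)
    have "isotone \<alpha>" "isotone \<beta>"
      using assms by (simp_all add: SS'_def LS_def)
    then have "the (\<alpha> x) \<le> the (\<alpha> y)"
      using * le unfolding isotone_def by blast
    then have "the (\<beta> x') \<le> the (\<beta> y')"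
      using * \<open>isotone \<beta>\<close> unfolding isotone_def by (metis domI option.sel)
    then show "the (pcomp \<alpha> \<beta> x) \<le> the (pcomp \<alpha> \<beta> y)"
      using * by (simp add: pcomp_def map_comp_def)
  qed
  moreover have "order_decreasing (pcomp \<alpha> \<beta>)"
    unfolding order_decreasing_def
  proof
    fix x assume "x \<in> dom (pcomp \<alpha> \<beta>)"
    then obtain x' x'' where *: "\<alpha> x = Some x'" "\<beta> x' = Some x''"
      by (auto simp: pcomp_def map_comp_Some_iff)
    have "order_decreasing \<alpha>" "order_decreasing \<beta>"
      using assms by (simp_all add: SS'_def LS_def)
    then have "the (\<alpha> x) \<le> x" "the (\<beta> x') \<le> x'"
      using * unfolding order_decreasing_def by blast+
    then show "the (pcomp \<alpha> \<beta> x) \<le> x"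
      using * by (simp add: pcomp_def map_comp_def)
  qed
  moreover have "dom \<alpha> \<subseteq> {1..n}" "1 \<notin> dom \<alpha>" "ran \<beta> \<subseteq> {1..n}"
    using assms by (simp_all add: SS'_def LS_def partial_transformations_def)
  ultimately show ?thesis
    using ran dom unfolding SS'_def LS_def partial_transformations_def by blast
qed

end

theory Submission
  imports Defs
begin

text \<open>Write \<open>e\<close> for the identity map on \<open>{2..n}\<close>. Two maps agree after left multiplication by \<open>\<alpha>\<close>
  iff they agree on the image of \<open>\<alpha>\<close>. Restrictions of \<open>e\<close> detect the image points \<open>v \<ge> 2\<close>, and
  the pair \<open>(1, e)\<close> of \<open>S\<^sup>1\<close> detects whether \<open>1\<close> is in the image. Dually, restrictions of
  \<open>e\<close> detect the domain and the pairs of maps \<open>q \<mapsto> p\<close>, \<open>q \<mapsto> q\<close> detect the kernel. For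
  \<open>\<D>\<^sup>*\<close>, replacing each value of \<open>\<alpha>\<close> by its rank in the image of \<open>\<alpha>\<close> keeps the kernel and
  gives a map, still order-decreasing, whose image is \<open>{1..|Im \<alpha>|}\<close>; so maps of equal rank are related
  in \<open>\<R>\<^sup>* \<circ> \<L>\<^sup>* \<circ> \<R>\<^sup>*\<close>.\<close>

section \<open>Membership in \<open>SS' n\<close> and its simplest elements\<close>

lemma isotoneD: "isotone \<alpha> \<Longrightarrow> \<alpha> x = Some u \<Longrightarrow> \<alpha> y = Some v \<Longrightarrow> x \<le> y \<Longrightarrow> u \<le> v"
  unfolding isotone_def by (metis domI option.sel)

text \<open>The bound \<open>2 \<le> x\<close> merges \<open>1 \<notin> dom \<alpha>\<close> with
  the domain lying in \<open>{1..n}\<close>; that values are at most \<open>n\<close> follows from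
  \<open>u \<le> x\<close> and \<open>x \<le> n\<close>.\<close>

lemma SS'_iff:
  "\<alpha> \<in> SS' n \<longleftrightarrow>
     (\<forall>x u. \<alpha> x = Some u \<longrightarrow> 2 \<le> x \<and> x \<le> n \<and> 1 \<le> u \<and> u \<le> x) \<and>
     (\<forall>x y u v. \<alpha> x = Some u \<longrightarrow> \<alpha> y = Some v \<longrightarrow> x \<le> y \<longrightarrow> u \<le> v)" (is "?L \<longleftrightarrow> ?R")
proof
  assume L: ?L
  have "2 \<le> x \<and> x \<le> n \<and> 1 \<le> u \<and> u \<le> x" if "\<alpha> x = Some u" for x u
  proof -
    have "x \<in> dom \<alpha>" "u \<in> ran \<alpha>" using that by (auto intro: ranI)
    moreover have "x \<noteq> 1" using L \<open>x \<in> dom \<alpha>\<close> by (auto simp: SS'_def)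
    ultimately have "x \<in> {1..n}" "u \<in> {1..n}" "the (\<alpha> x) \<le> x"
      using L unfolding SS'_def LS_def partial_transformations_def order_decreasing_def by blast+
    then show ?thesis using that \<open>x \<noteq> 1\<close> by auto
  qed
  moreover have "u \<le> v" if "\<alpha> x = Some u" "\<alpha> y = Some v" "x \<le> y" for x y u v
    using L isotoneD[OF _ that] by (simp add: SS'_def LS_def)
  ultimately show ?R by blast
next
  assume R: ?R
  then have "dom \<alpha> \<subseteq> {1..n}" "ran \<alpha> \<subseteq> {1..n}" "1 \<notin> dom \<alpha>"
    by (fastforce simp: ran_def)+
  moreover have "isotone \<alpha>" "order_decreasing \<alpha>"
    using R by (auto simp: isotone_def order_decreasing_def)
  ultimately show ?L by (simp add: SS'_def LS_def partial_transformations_def)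
qed

lemma SS'_SomeD: "\<alpha> \<in> SS' n \<Longrightarrow> \<alpha> x = Some u \<Longrightarrow> 2 \<le> x \<and> x \<le> n \<and> 1 \<le> u \<and> u \<le> x"
  unfolding SS'_iff by blast

lemma SS'_mono: "\<alpha> \<in> SS' n \<Longrightarrow> \<alpha> x = Some u \<Longrightarrow> \<alpha> y = Some v \<Longrightarrow> x \<le> y \<Longrightarrow> u \<le> v"
  unfolding SS'_iff by blast

lemma dom_SS': "\<alpha> \<in> SS' n \<Longrightarrow> dom \<alpha> \<subseteq> {2..n}"
  using SS'_SomeD by fastforce

lemma ran_SS': "\<alpha> \<in> SS' n \<Longrightarrow> ran \<alpha> \<subseteq> {1..n}"
  by (auto simp: SS'_def LS_def partial_transformations_def)

definition id_on :: "nat set \<Rightarrow> nat \<rightharpoonup> nat" where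
  "id_on A = (\<lambda>x. if x \<in> A then Some x else None)"

lemma id_on_SS': "A \<subseteq> {2..n} \<Longrightarrow> id_on A \<in> SS' n"
  by (force simp: SS'_iff id_on_def split: if_splits)

lemma singleton_SS': "2 \<le> q \<Longrightarrow> q \<le> n \<Longrightarrow> 1 \<le> p \<Longrightarrow> p \<le> q \<Longrightarrow> [q \<mapsto> p] \<in> SS' n"
  by (auto simp: SS'_iff split: if_splits)

text \<open>A right identity for \<open>[2 \<mapsto> 1]\<close> would have to fix 1, which lies in
  no domain. Hence \<open>One\<close> really is adjoined.\<close>

lemma not_has_identity_SS':
  assumes "n \<ge> 2"
  shows "\<not> has_identity (SS' n) pcomp"
proof
  assume "has_identity (SS' n) pcomp"
  moreover have "[2 \<mapsto> 1] \<in> SS' n" using assms by (intro singleton_SS') auto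
  ultimately obtain e where e: "e \<in> SS' n" and "pcomp [2 \<mapsto> 1] e = [2 \<mapsto> 1]"
    unfolding has_identity_def by blast
  then have "pcomp [2 \<mapsto> 1] e 2 = Some 1" by simp
  then have "e 1 = Some 1" by (simp add: pcomp_def)
  then show False using SS'_SomeD[OF e] by force
qed

lemma adjoin_one_SS': "n \<ge> 2 \<Longrightarrow> adjoin_one (SS' n) pcomp = insert One (Elt ` SS' n)"
  by (simp add: adjoin_one_def not_has_identity_SS')

section \<open>Cancellation conditions as equations between partial maps\<close>

text \<open>Reading \<open>One\<close> as the total map \<open>Some\<close> turns every product with
  an element of \<open>S\<^sup>1\<close> into one composition of partial maps, with no case
  split.\<close>

fun one_act :: "('a \<rightharpoonup> 'a) with_one \<Rightarrow> 'a \<rightharpoonup> 'a" where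
  "one_act One = Some"
| "one_act (Elt f) = f"

lemma mult_one_left: "mult_one pcomp (Elt a) x = Elt (one_act x \<circ>\<^sub>m a)"
  by (cases x) (auto simp: pcomp_def map_comp_def fun_eq_iff split: option.splits)

lemma mult_one_right: "mult_one pcomp x (Elt a) = Elt (a \<circ>\<^sub>m one_act x)"
  by (cases x) (auto simp: pcomp_def map_comp_def fun_eq_iff split: option.splits)

lemma map_comp_eq_iff_ran: "f \<circ>\<^sub>m a = g \<circ>\<^sub>m a \<longleftrightarrow> (\<forall>v\<in>ran a. f v = g v)"
  by (fastforce simp: fun_eq_iff map_comp_def ran_def split: option.splits)

text \<open>The diagonal of the kernel records the domain, so the kernel alone decides equality of
  values, \<open>None\<close> included.\<close>

lemma eq_iff_pker:
  "a p = a q \<longleftrightarrow> (p, q) \<in> pker a \<or> ((p, p) \<notin> pker a \<and> (q, q) \<notin> pker a)"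
  by (cases "a p"; cases "a q") (auto simp: pker_def)

lemma pker_refl_iff: "(p, p) \<in> pker a \<longleftrightarrow> p \<in> dom a"
  by (auto simp: pker_def)

lemma map_comp_eq_if_pker_eq:
  assumes "pker a = pker b" "a \<circ>\<^sub>m f = a \<circ>\<^sub>m g"
  shows "b \<circ>\<^sub>m f = b \<circ>\<^sub>m g"
proof
  fix z
  have same: "a p = a q \<longleftrightarrow> b p = b q" for p q
    unfolding eq_iff_pker assms(1) ..
  \<comment> \<open>Needed at points where exactly one of \<open>f\<close> and \<open>g\<close> is
    defined.\<close>
  have undef: "a p = None \<longleftrightarrow> b p = None" for p
    using assms(1) pker_refl_iff[of p a] pker_refl_iff[of p b] by auto
  show "(b \<circ>\<^sub>m f) z = (b \<circ>\<^sub>m g) z"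
    using fun_cong[OF assms(2), of z] same undef[THEN sym]
    by (cases "f z"; cases "g z") (simp_all add: eq_commute[of None])
qed

section \<open>The relations L* and R*\<close>

lemma L_star_SS'_iff:
  assumes "n \<ge> 2" "\<alpha> \<in> SS' n" "\<beta> \<in> SS' n"
  shows "(\<alpha>, \<beta>) \<in> L_star (SS' n) pcomp \<longleftrightarrow> ran \<alpha> = ran \<beta>"
proof
  assume L: "(\<alpha>, \<beta>) \<in> L_star (SS' n) pcomp"
  have iff: "(\<forall>v\<in>ran \<alpha>. one_act x v = one_act y v) \<longleftrightarrow> (\<forall>v\<in>ran \<beta>. one_act x v = one_act y v)"
    if "x \<in> insert One (Elt ` SS' n)" "y \<in> insert One (Elt ` SS' n)" for x y
    using L that unfolding L_star_def adjoin_one_SS'[OF assms(1)] mem_Collect_eq prod.case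
      mult_one_left with_one.inject map_comp_eq_iff_ran by blast
  have "v \<in> ran \<alpha> \<longleftrightarrow> v \<in> ran \<beta>" for v
  proof (cases "v = 1")
    case True
    \<comment> \<open>On \<open>{1..n}\<close> the maps \<open>Some\<close> and
      \<open>id_on {2..n}\<close> differ only at 1.\<close>
    have "one_act One u = one_act (Elt (id_on {2..n})) u \<longleftrightarrow> u \<noteq> v" if "u \<in> {1..n}" for u
      using that True by (auto simp: id_on_def)
    then have "(\<forall>u\<in>ran \<gamma>. one_act One u = one_act (Elt (id_on {2..n})) u) \<longleftrightarrow> v \<notin> ran \<gamma>"
      if "\<gamma> \<in> SS' n" for \<gamma>
      using ran_SS'[OF that] by blast
    then show ?thesis
      using iff[of One "Elt (id_on {2..n})"] assms(2,3) id_on_SS'[OF order_refl] by auto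
  next
    case False
    \<comment> \<open>The two restrictions differ at most at \<open>v\<close>; if \<open>v\<close>
      is outside \<open>{2..n}\<close> they coincide, and no \<open>u\<close> in range equals
      \<open>v\<close>.\<close>
    have "one_act (Elt (id_on {2..n})) u = one_act (Elt (id_on ({2..n} - {v}))) u \<longleftrightarrow> u \<noteq> v"
      if "u \<in> {1..n}" for u
      using that False by (auto simp: id_on_def)
    then have "(\<forall>u\<in>ran \<gamma>. one_act (Elt (id_on {2..n})) u = one_act (Elt (id_on ({2..n} - {v}))) u)
        \<longleftrightarrow> v \<notin> ran \<gamma>"
      if "\<gamma> \<in> SS' n" for \<gamma>
      using ran_SS'[OF that] by blast
    then show ?thesis
      using iff[of "Elt (id_on {2..n})" "Elt (id_on ({2..n} - {v}))"] assms(2,3)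
        id_on_SS'[OF order_refl, of n] id_on_SS'[of "{2..n} - {v}" n] by auto
  qed
  then show "ran \<alpha> = ran \<beta>" by blast
next
  assume "ran \<alpha> = ran \<beta>"
  then show "(\<alpha>, \<beta>) \<in> L_star (SS' n) pcomp"
    using assms by (simp add: L_star_def mult_one_left map_comp_eq_iff_ran)
qed

text \<open>One inclusion is enough, since R* is symmetric.\<close>

lemma R_star_SS'_pker_subset:
  assumes "n \<ge> 2" "(\<alpha>, \<beta>) \<in> R_star (SS' n) pcomp"
  shows "pker \<alpha> \<subseteq> pker \<beta>"
proof -
  have iff: "\<alpha> \<circ>\<^sub>m f = \<alpha> \<circ>\<^sub>m g \<longleftrightarrow> \<beta> \<circ>\<^sub>m f = \<beta> \<circ>\<^sub>m g" if "f \<in> SS' n" "g \<in> SS' n" for f g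
    using assms(2) that unfolding R_star_def adjoin_one_SS'[OF assms(1)]
    by (simp add: mult_one_right)
  have \<alpha>: "\<alpha> \<in> SS' n" using assms(2) by (simp add: R_star_def)
  have dom: "x \<in> dom \<beta>" if "x \<in> dom \<alpha>" for x
  proof (rule ccontr)
    assume "x \<notin> dom \<beta>"
    then have "\<beta> \<circ>\<^sub>m id_on {2..n} = \<beta> \<circ>\<^sub>m id_on ({2..n} - {x})"
      by (auto simp: fun_eq_iff map_comp_def id_on_def)
    then have "\<alpha> \<circ>\<^sub>m id_on {2..n} = \<alpha> \<circ>\<^sub>m id_on ({2..n} - {x})"
      using iff id_on_SS'[OF order_refl, of n] id_on_SS'[of "{2..n} - {x}" n] by blast
    then have "(\<alpha> \<circ>\<^sub>m id_on {2..n}) x = None"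
      by (simp add: map_comp_def id_on_def)
    moreover have "x \<in> {2..n}" using dom_SS'[OF \<alpha>] that by blast
    ultimately show False using that by (auto simp: map_comp_def id_on_def)
  qed
  \<comment> \<open>The order \<open>p \<le> q\<close> makes \<open>[q \<mapsto> p]\<close>
    order-decreasing; the opposite case is recovered by swapping \<open>p\<close> and
    \<open>q\<close>.\<close>
  have ker: "\<beta> p = \<beta> q" if "\<alpha> p = \<alpha> q" "p \<in> dom \<alpha>" "q \<in> dom \<alpha>" "p \<le> q" for p q
  proof -
    have "2 \<le> p" "q \<le> n" using dom_SS'[OF \<alpha>] that by auto
    then have "[q \<mapsto> p] \<in> SS' n" "[q \<mapsto> q] \<in> SS' n" using that by (auto intro: singleton_SS')
    moreover have "\<alpha> \<circ>\<^sub>m [q \<mapsto> p] = \<alpha> \<circ>\<^sub>m [q \<mapsto> q]"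
      using that by (auto simp: fun_eq_iff map_comp_def)
    ultimately have "\<beta> \<circ>\<^sub>m [q \<mapsto> p] = \<beta> \<circ>\<^sub>m [q \<mapsto> q]" using iff by blast
    then have "(\<beta> \<circ>\<^sub>m [q \<mapsto> p]) q = (\<beta> \<circ>\<^sub>m [q \<mapsto> q]) q" by simp
    then show ?thesis by simp
  qed
  show ?thesis
  proof safe
    fix p q assume "(p, q) \<in> pker \<alpha>"
    then have *: "p \<in> dom \<alpha>" "q \<in> dom \<alpha>" "\<alpha> p = \<alpha> q"
      by (auto simp: pker_def)
    then have "\<beta> p = \<beta> q" using ker[of p q] ker[of q p] by (metis nat_le_linear)
    then show "(p, q) \<in> pker \<beta>" using dom * by (simp add: pker_def)
  qed
qed

lemma R_star_SS'_iff:
  assumes "n \<ge> 2" "\<alpha> \<in> SS' n" "\<beta> \<in> SS' n"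
  shows "(\<alpha>, \<beta>) \<in> R_star (SS' n) pcomp \<longleftrightarrow> pker \<alpha> = pker \<beta>"
proof
  assume R: "(\<alpha>, \<beta>) \<in> R_star (SS' n) pcomp"
  then have "(\<beta>, \<alpha>) \<in> R_star (SS' n) pcomp" by (simp add: R_star_def)
  with R show "pker \<alpha> = pker \<beta>" using R_star_SS'_pker_subset[OF assms(1)] by blast
next
  assume ker: "pker \<alpha> = pker \<beta>"
  have "\<alpha> \<circ>\<^sub>m f = \<alpha> \<circ>\<^sub>m g \<longleftrightarrow> \<beta> \<circ>\<^sub>m f = \<beta> \<circ>\<^sub>m g" for f g :: "nat \<rightharpoonup> nat"
    using map_comp_eq_if_pker_eq[OF ker] map_comp_eq_if_pker_eq[OF ker[symmetric]] by blast
  then show "(\<alpha>, \<beta>) \<in> R_star (SS' n) pcomp"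
    using assms(2,3) by (simp add: R_star_def mult_one_right)
qed

section \<open>The relation H*: image and kernel determine an isotone map\<close>

text \<open>If \<open>u < v\<close>, a \<open>\<beta>\<close>-preimage \<open>z\<close> of
  \<open>u\<close> lies below \<open>x\<close> by isotonicity. There the maps agree, so
  \<open>z\<close> and \<open>x\<close> share a kernel class, forcing \<open>u = v\<close>. The
  hypothesis \<open>below\<close> is supplied later by strong induction on \<open>x\<close>.\<close>

lemma isotone_le_if_ran_pker_eq:
  assumes iso: "isotone \<alpha>" "isotone \<beta>" and ran: "ran \<alpha> = ran \<beta>" and ker: "pker \<alpha> = pker \<beta>"
    and below: "\<And>z. z < x \<Longrightarrow> \<alpha> z = \<beta> z" and x: "\<alpha> x = Some u" "\<beta> x = Some v"
  shows "v \<le> u"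
proof (rule ccontr)
  assume "\<not> v \<le> u"
  have "u \<in> ran \<beta>" using x ran by (auto intro: ranI)
  then obtain z where z: "\<beta> z = Some u" by (auto simp: ran_def)
  have "z < x"
  proof (rule ccontr)
    assume "\<not> z < x"
    then have "v \<le> u" using isotoneD[OF iso(2) x(2) z] by simp
    with \<open>\<not> v \<le> u\<close> show False ..
  qed
  then have "(z, x) \<in> pker \<alpha>" using below[of z] x z by (auto simp: pker_def)
  then have "(z, x) \<in> pker \<beta>" using ker by simp
  then have "u = v" using x z by (simp add: pker_def)
  with \<open>\<not> v \<le> u\<close> show False by simp
qed

lemma isotone_eq_if_ran_pker_eq:
  assumes "isotone \<alpha>" "isotone \<beta>" "ran \<alpha> = ran \<beta>" "pker \<alpha> = pker \<beta>"
  shows "\<alpha> = \<beta>"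
proof
  fix x show "\<alpha> x = \<beta> x"
  proof (induction x rule: less_induct)
    case (less x)
    have "x \<in> dom \<alpha> \<longleftrightarrow> x \<in> dom \<beta>" using assms(4) pker_refl_iff by metis
    then consider "\<alpha> x = None" "\<beta> x = None" | u v where "\<alpha> x = Some u" "\<beta> x = Some v"
      by (cases "\<alpha> x"; cases "\<beta> x") auto
    then show ?case
    proof cases
      case 2
      have "v \<le> u" using isotone_le_if_ran_pker_eq[of \<alpha> \<beta> x u v] assms less 2 by simp
      moreover have "u \<le> v" using isotone_le_if_ran_pker_eq[of \<beta> \<alpha> x v u] assms less 2 by simp
      ultimately show ?thesis using 2 by simp
    qed simp
  qed
qed

section \<open>The relation D*: rank as the invariant, and a normal form for the image\<close>

lemma finite_ran_SS': "\<alpha> \<in> SS' n \<Longrightarrow> finite (ran \<alpha>)"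
  using ran_SS' finite_subset by blast

text \<open>Both images are indexed by the common kernel classes: \<open>g\<close> picks a point in
  the class over \<open>v\<close>, and \<open>h\<close> sends \<open>v\<close> to the
  \<open>\<beta>\<close>-value there.\<close>

lemma card_ran_le_if_pker_eq:
  assumes "pker \<alpha> = pker \<beta>" "finite (ran \<beta>)"
  shows "card (ran \<alpha>) \<le> card (ran \<beta>)"
proof -
  have "\<exists>x w. \<alpha> x = Some v \<and> \<beta> x = Some w" if "v \<in> ran \<alpha>" for v
  proof -
    from that obtain x where x: "\<alpha> x = Some v" by (auto simp: ran_def)
    then have "x \<in> dom \<beta>" using assms(1) pker_refl_iff by (metis domI)
    with x show ?thesis by auto
  qed
  then obtain g h where gh: "\<And>v. v \<in> ran \<alpha> \<Longrightarrow> \<alpha> (g v) = Some v \<and> \<beta> (g v) = Some (h v)"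
    by metis
  have "inj_on h (ran \<alpha>)"
  proof (rule inj_onI)
    fix v w assume *: "v \<in> ran \<alpha>" "w \<in> ran \<alpha>" "h v = h w"
    then have "(g v, g w) \<in> pker \<beta>" using gh by (auto simp: pker_def)
    then have "(g v, g w) \<in> pker \<alpha>" using assms(1) by simp
    then show "v = w" using gh[OF *(1)] gh[OF *(2)] by (simp add: pker_def)
  qed
  moreover have "h ` ran \<alpha> \<subseteq> ran \<beta>" using gh by (auto intro: ranI)
  ultimately show ?thesis using assms(2) by (rule card_inj_on_le)
qed

text \<open>For \<open>v\<close> in a finite \<open>A\<close> this is the position of
  \<open>v\<close> in the increasing enumeration of \<open>A\<close>, counted from 1.\<close>

definition rank_in :: "nat set \<Rightarrow> nat \<Rightarrow> nat" where
  "rank_in A v = card {u \<in> A. u \<le> v}"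

lemma rank_in_mono: "finite A \<Longrightarrow> v \<le> w \<Longrightarrow> rank_in A v \<le> rank_in A w"
  unfolding rank_in_def by (rule card_mono) auto

lemma rank_in_strict_mono: "finite A \<Longrightarrow> w \<in> A \<Longrightarrow> v < w \<Longrightarrow> rank_in A v < rank_in A w"
  unfolding rank_in_def
  by (intro psubset_card_mono psubsetI notI) (auto dest: equalityD2 dest!: subsetD[where c = w])

lemma inj_on_rank_in: "finite A \<Longrightarrow> inj_on (rank_in A) A"
  by (rule inj_onI) (metis less_irrefl linorder_neqE_nat rank_in_strict_mono)

text \<open>The elements counted lie in \<open>{1..v}\<close>. This is what keeps the map
  order-decreasing when values are replaced by ranks.\<close>

lemma rank_in_le:
  assumes "0 \<notin> A"
  shows "rank_in A v \<le> v"
proof -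
  have "rank_in A v \<le> card {1..v}"
    unfolding rank_in_def using assms
    by (intro card_mono) (auto simp: Suc_le_eq intro: gr0I)
  then show ?thesis by simp
qed

lemma rank_in_pos: "finite A \<Longrightarrow> v \<in> A \<Longrightarrow> 1 \<le> rank_in A v"
  unfolding rank_in_def by (auto simp: Suc_le_eq card_gt_0_iff)

lemma rank_in_image:
  assumes "finite A"
  shows "rank_in A ` A = {1..card A}"
proof (rule card_subset_eq)
  have "rank_in A v \<le> card A" for v
    unfolding rank_in_def using assms by (intro card_mono) auto
  then show "rank_in A ` A \<subseteq> {1..card A}" using rank_in_pos[OF assms] by auto
  show "card (rank_in A ` A) = card {1..card A}"
    using card_image[OF inj_on_rank_in[OF assms]] by simp
qed simp

lemma exists_SS'_same_pker_initial_ran: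
  assumes "\<alpha> \<in> SS' n"
  shows "\<exists>\<gamma>\<in>SS' n. pker \<gamma> = pker \<alpha> \<and> ran \<gamma> = {1..card (ran \<alpha>)}"
proof
  let ?r = "rank_in (ran \<alpha>)"
  let ?\<gamma> = "map_option ?r \<circ> \<alpha>"
  have fin: "finite (ran \<alpha>)" using assms by (rule finite_ran_SS')
  have z: "0 \<notin> ran \<alpha>" using ran_SS'[OF assms] by auto
  have bnd: "2 \<le> x \<and> x \<le> n \<and> 1 \<le> ?r u \<and> ?r u \<le> x" if "\<alpha> x = Some u" for x u
  proof -
    show ?thesis
      using SS'_SomeD[OF assms that] rank_in_le[OF z, of u] rank_in_pos[OF fin ranI[of \<alpha>, OF that]] by simp
  qed
  have "?r u \<le> ?r v" if "\<alpha> x = Some u" "\<alpha> y = Some v" "x \<le> y" for x y u v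
    using SS'_mono[OF assms that] by (rule rank_in_mono[OF fin])
  with bnd show "?\<gamma> \<in> SS' n" unfolding SS'_iff by auto
  have "pker ?\<gamma> = pker \<alpha>"
    \<comment> \<open>Ranking is injective on the image, so no kernel classes merge.\<close>
    by (auto simp: pker_def inj_on_eq_iff[OF inj_on_rank_in[OF fin]] ranI)
  moreover have "ran ?\<gamma> = ?r ` ran \<alpha>" by (auto simp: ran_def)
  ultimately show "pker ?\<gamma> = pker \<alpha> \<and> ran ?\<gamma> = {1..card (ran \<alpha>)}"
    using rank_in_image[OF fin] by simp
qed

lemma D_star_SS'_iff:
  assumes "n \<ge> 2" "\<alpha> \<in> SS' n" "\<beta> \<in> SS' n"
  shows "(\<alpha>, \<beta>) \<in> D_star (SS' n) pcomp \<longleftrightarrow> card (ran \<alpha>) = card (ran \<beta>)"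
proof
  \<comment> \<open>Equality of rank is an equivalence containing L* and R*, hence it contains their
    join.\<close>
  let ?E = "{(a, b). a \<in> SS' n \<and> b \<in> SS' n \<and> card (ran a) = card (ran b)}"
  have "equiv (SS' n) ?E"
    by (rule equivI) (auto simp: refl_on_def sym_def trans_def)
  moreover have "L_star (SS' n) pcomp \<subseteq> ?E"
  proof safe
    fix a b assume L: "(a, b) \<in> L_star (SS' n) pcomp"
    then show "a \<in> SS' n" "b \<in> SS' n" by (simp_all add: L_star_def)
    with L show "card (ran a) = card (ran b)" using L_star_SS'_iff[OF assms(1)] by simp
  qed
  moreover have "R_star (SS' n) pcomp \<subseteq> ?E"
  proof safe
    fix a b assume R: "(a, b) \<in> R_star (SS' n) pcomp"
    then show ab: "a \<in> SS' n" "b \<in> SS' n" by (simp_all add: R_star_def)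
    with R have "pker a = pker b" using R_star_SS'_iff[OF assms(1)] by simp
    then show "card (ran a) = card (ran b)"
      using ab by (intro antisym card_ran_le_if_pker_eq finite_ran_SS') auto
  qed
  moreover assume "(\<alpha>, \<beta>) \<in> D_star (SS' n) pcomp"
  ultimately have "(\<alpha>, \<beta>) \<in> ?E" unfolding D_star_def by blast
  then show "card (ran \<alpha>) = card (ran \<beta>)" by simp
next
  assume card: "card (ran \<alpha>) = card (ran \<beta>)"
  obtain \<gamma> where \<gamma>: "\<gamma> \<in> SS' n" "pker \<gamma> = pker \<alpha>" "ran \<gamma> = {1..card (ran \<alpha>)}"
    using exists_SS'_same_pker_initial_ran[OF assms(2)] by blast
  obtain \<delta> where \<delta>: "\<delta> \<in> SS' n" "pker \<delta> = pker \<beta>" "ran \<delta> = {1..card (ran \<beta>)}"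
    using exists_SS'_same_pker_initial_ran[OF assms(3)] by blast
  \<comment> \<open>Equal ranks give \<open>\<gamma>\<close> and \<open>\<delta>\<close> the same
    initial segment as image, which supplies the middle L* link.\<close>
  have "(\<alpha>, \<gamma>) \<in> R_star (SS' n) pcomp" "(\<gamma>, \<delta>) \<in> L_star (SS' n) pcomp"
    "(\<delta>, \<beta>) \<in> R_star (SS' n) pcomp"
    using assms \<gamma> \<delta> card by (simp_all add: R_star_SS'_iff L_star_SS'_iff)
  then have "(\<alpha>, \<beta>) \<in> E" if "equiv (SS' n) E" "L_star (SS' n) pcomp \<subseteq> E" "R_star (SS' n) pcomp \<subseteq> E"
    for E
    using that transD[of E] unfolding equiv_def by (meson subsetD)
  then show "(\<alpha>, \<beta>) \<in> D_star (SS' n) pcomp"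
    unfolding D_star_def by simp
qed

theorem theorem2p11:
  fixes n :: nat and \<alpha> \<beta> :: "nat \<rightharpoonup> nat"
  assumes "n \<ge> 2" and "\<alpha> \<in> SS' n" and "\<beta> \<in> SS' n"
  shows "((\<alpha>, \<beta>) \<in> L_star (SS' n) pcomp \<longleftrightarrow> ran \<alpha> = ran \<beta>)
       \<and> ((\<alpha>, \<beta>) \<in> R_star (SS' n) pcomp \<longleftrightarrow> pker \<alpha> = pker \<beta>)
       \<and> ((\<alpha>, \<beta>) \<in> H_star (SS' n) pcomp \<longleftrightarrow> \<alpha> = \<beta>)
       \<and> ((\<alpha>, \<beta>) \<in> D_star (SS' n) pcomp \<longleftrightarrow> card (ran \<alpha>) = card (ran \<beta>))"
proof -
  have "isotone \<alpha>" "isotone \<beta>" using assms by (simp_all add: SS'_def LS_def)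
  then have "(\<alpha>, \<beta>) \<in> H_star (SS' n) pcomp \<longleftrightarrow> \<alpha> = \<beta>"
    using assms isotone_eq_if_ran_pker_eq[of \<alpha> \<beta>]
    by (auto simp: H_star_def L_star_SS'_iff R_star_SS'_iff)
  then show ?thesis
    using L_star_SS'_iff[OF assms] R_star_SS'_iff[OF assms] D_star_SS'_iff[OF assms] by blast
qed

end
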